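(* Let $\Delta$ be a simplicial complex on the finite vertex set $V$, let $W$ be a subset of $V$, and let $\chi$ be a coloring (that is, an $s$-coloring for some $s$) of the restriction $\Delta|_W$. If $|V \setminus W| \leq 3$, then the (partially whiskered) simplicial complex $\Delta_\chi$ is vertex decomposable.
   Context: A finite simplicial complex $\Delta$ on a finite vertex set $V$ is a collection of subsets of $V$ (faces) such that $\sigma \in \Delta$ and $\tau \subseteq \sigma$ imply $\tau \in \Delta$; the empty set is always taken to be a face of $\Delta$. Facets are the maximal faces under inclusion. A simplex is a complex having exactly one facet; the complex $\{\emptyset\}$ counts as a simplex. For a face $\sigma \in \Delta$, the deletion is $\Delta \setminus \sigma = \{\tau \in \Delta : \sigma \not\subseteq \tau\}$ and the link is $\mathrm{link}_\Delta(\sigma) = \{\tau \in \Delta : \sigma \cap \tau = \emptyset,\ \sigma \cup \tau \in \Delta\}$. For $\{v\}\in\Delta$ one writes $\Delta\setminus v$ and $\mathrm{link}_\Delta(v)$ for $\Delta \setminus \{v\}$ and $\mathrm{link}_\Delta(\{v\})$. Vertex decomposable (non-pure sense), defined recursively: $\Delta$ is vertex decomposable if either $\Delta$ is a simplex, or there is a vertex $v$ (with $\{v\}\in\Delta$) such that $\Delta \setminus v$ and $\mathrm{link}_\Delta(v)$ are both vertex decomposable and have no facet in common. Restriction: for $U \subseteq V$, $\Delta|_U = \{\sigma \in \Delta : \sigma \subseteq U\}$. An $s$-coloring of a simplicial complex with vertex set $W$ is a partition $W = W_1 \cup \dots \cup W_s$ into pairwise disjoint (possibly empty) sets such that $|F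 \cap W_j| \le 1$ for every facet $F$ and every $1 \le j \le s$. Construction of $\Delta_\chi$: given $\Delta$ on $V = \{x_1,\dots,x_n\}$, $W \subseteq V$, and an $s$-coloring $\chi$ of $\Delta|_W$ given by $W = W_1 \cup \dots \cup W_s$, let $y_1,\dots,y_s$ be new vertices. Then $\Delta_\chi$ is the simplicial complex on $\{x_1,\dots,x_n,y_1,\dots,y_s\}$ whose faces are the sets $\sigma \cup \tau$ with $\sigma \in \Delta$ and $\tau \subseteq \{y_1,\dots,y_s\}$ such that $\sigma \cap W_j = \emptyset$ for every $y_j \in \tau$. *)

theory Defs
  imports Main "HOL-Library.Disjoint_Sets"
begin

text \<open>
  An element of the vertex set \<open>V\<close> need not be a vertex of the complex: \<open>{v}\<close> may fail to be a face.
\<close>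

definition simplicial_complex :: "'a set \<Rightarrow> 'a set set \<Rightarrow> bool" where
  "simplicial_complex V \<Delta> \<longleftrightarrow>
     finite V \<and> \<Delta> \<subseteq> Pow V \<and> {} \<in> \<Delta> \<and> (\<forall>\<sigma>\<in>\<Delta>. \<forall>\<tau>. \<tau> \<subseteq> \<sigma> \<longrightarrow> \<tau> \<in> \<Delta>)"

definition facets :: "'a set set \<Rightarrow> 'a set set" where
  "facets \<Delta> = {F \<in> \<Delta>. \<forall>G\<in>\<Delta>. F \<subseteq> G \<longrightarrow> G = F}"

definition is_simplex :: "'a set set \<Rightarrow> bool" where
  "is_simplex \<Delta> \<longleftrightarrow> (\<exists>V. simplicial_complex V \<Delta>) \<and> (\<exists>!F. F \<in> facets \<Delta>)"

definition deletion :: "'a set set \<Rightarrow> 'a set \<Rightarrow> 'a set set" where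
  "deletion \<Delta> \<sigma> = {\<tau> \<in> \<Delta>. \<not> \<sigma> \<subseteq> \<tau>}"

definition link :: "'a set set \<Rightarrow> 'a set \<Rightarrow> 'a set set" where
  "link \<Delta> \<sigma> = {\<tau> \<in> \<Delta>. \<sigma> \<inter> \<tau> = {} \<and> \<sigma> \<union> \<tau> \<in> \<Delta>}"

definition restriction :: "'a set set \<Rightarrow> 'a set \<Rightarrow> 'a set set" where
  "restriction \<Delta> U = {\<sigma> \<in> \<Delta>. \<sigma> \<subseteq> U}"

inductive vertex_decomposable :: "'a set set \<Rightarrow> bool" where
  simplex: "is_simplex \<Delta> \<Longrightarrow> vertex_decomposable \<Delta>"
| shedding:
    "\<lbrakk>simplicial_complex V \<Delta>; {v} \<in> \<Delta>;
      vertex_decomposable (deletion \<Delta> {v}); vertex_decomposable (link \<Delta> {v});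
      facets (deletion \<Delta> {v}) \<inter> facets (link \<Delta> {v}) = {}\<rbrakk>
     \<Longrightarrow> vertex_decomposable \<Delta>"

text \<open>The colour classes are \<open>C 1, \<dots>, C s\<close>; the values of \<open>C\<close> outside \<open>{1..s}\<close> are irrelevant.\<close>

definition coloring :: "'a set \<Rightarrow> 'a set set \<Rightarrow> nat \<Rightarrow> (nat \<Rightarrow> 'a set) \<Rightarrow> bool" where
  "coloring W \<Delta> s C \<longleftrightarrow>
     W = (\<Union>j\<in>{1..s}. C j) \<and> disjoint_family_on C {1..s} \<and>
     (\<forall>F\<in>facets \<Delta>. \<forall>j\<in>{1..s}. card (F \<inter> C j) \<le> 1)"

text \<open>
  The vertices live in a sum type: \<open>Inl x\<close> is the old vertex \<open>x\<close>, and \<open>Inr j\<close>, for \<open>j\<close> in \<open>{1..s}\<close>,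
  is the new vertex \<open>y\<^sub>j\<close>.
\<close>

definition partial_whiskering ::
    "'a set set \<Rightarrow> nat \<Rightarrow> (nat \<Rightarrow> 'a set) \<Rightarrow> ('a + nat) set set" where
  "partial_whiskering \<Delta> s C =
     {Inl ` \<sigma> \<union> Inr ` T | \<sigma> T. \<sigma> \<in> \<Delta> \<and> T \<subseteq> {1..s} \<and> (\<forall>j\<in>T. \<sigma> \<inter> C j = {})}"

lemma simplicial_complex_partial_whiskering:
  assumes "simplicial_complex V \<Delta>"
  shows "simplicial_complex (Inl ` V \<union> Inr ` {1..s}) (partial_whiskering \<Delta> s C)"
  unfolding simplicial_complex_def
proof (intro conjI ballI allI impI)
  show "finite (Inl ` V \<union> Inr ` {1..s})"
    using assms by (simp add: simplicial_complex_def)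
  show "partial_whiskering \<Delta> s C \<subseteq> Pow (Inl ` V \<union> Inr ` {1..s})"
    using assms by (force simp: partial_whiskering_def simplicial_complex_def)
  show "{} \<in> partial_whiskering \<Delta> s C"
  proof -
    have "{} = Inl ` {} \<union> Inr ` {}"
      by simp
    moreover have "{} \<in> \<Delta>"
      using assms by (simp add: simplicial_complex_def)
    ultimately show ?thesis
      unfolding partial_whiskering_def by blast
  qed
next
  fix \<rho> \<rho>' :: "('a + nat) set"
  assume "\<rho> \<in> partial_whiskering \<Delta> s C" and sub: "\<rho>' \<subseteq> \<rho>"
  then obtain \<sigma> T where \<rho>: "\<rho> = Inl ` \<sigma> \<union> Inr ` T" "\<sigma> \<in> \<Delta>" "T \<subseteq> {1..s}"
      "\<forall>j\<in>T. \<sigma> \<inter> C j = {}"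
    unfolding partial_whiskering_def by blast
  have "\<rho>' = Inl ` (Inl -` \<rho>') \<union> Inr ` (Inr -` \<rho>')"
    using sub \<rho>(1) by (auto simp: image_iff)
  moreover have s: "Inl -` \<rho>' \<subseteq> \<sigma>" and t: "Inr -` \<rho>' \<subseteq> T"
    using sub \<rho>(1) by auto
  moreover have "Inl -` \<rho>' \<in> \<Delta>"
    using assms \<rho>(2) s unfolding simplicial_complex_def by blast
  moreover have "\<forall>j\<in>Inr -` \<rho>'. Inl -` \<rho>' \<inter> C j = {}"
    using \<rho>(4) s t by blast
  moreover have "Inr -` \<rho>' \<subseteq> {1..s}"
    using t \<rho>(3) by simp
  ultimately show "\<rho>' \<in> partial_whiskering \<Delta> s C"
    unfolding partial_whiskering_def by (intro CollectI exI conjI)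
qed

end

theory Submission
  imports Defs
begin

text \<open>
  Shed a vertex \<open>w\<close> of \<open>\<Delta>\<close>.  Its deletion in the whiskered complex is the whiskering of
  \<open>\<Delta> \<setminus> w\<close>, and its link is the whiskering of \<open>link w\<close> with the colour of \<open>w\<close> dropped, so one can
  induct on the number of vertices.  A vertex \<open>w\<close> of colour \<open>j\<close> is always shedding, because \<open>y\<^sub>j\<close>
  can be added to every face of its link.  When no coloured vertex is left, at most three vertices
  remain, and unless the complex is a simplex, any vertex outside a face of largest cardinality is
  shedding.
\<close>

text \<open>Reading the old and the new part of a face off as preimages makes membership a plain
  conjunction, without witnesses for the two parts. The set \<open>T\<close> of colours is arbitrary
  because links drop colours, which need not leave an initial segment \<open>{1..s}\<close>.\<close>

definition whiskering :: "'a set set \<Rightarrow> 'b set \<Rightarrow> ('b \<Rightarrow> 'a set) \<Rightarrow> ('a + 'b) set set" where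
  "whiskering \<Delta> T C =
     {\<rho>. Inl -` \<rho> \<in> \<Delta> \<and> Inr -` \<rho> \<subseteq> T \<and> (\<forall>j\<in>Inr -` \<rho>. Inl -` \<rho> \<inter> C j = {})}"

lemma partial_whiskering_eq_whiskering:
  "partial_whiskering \<Delta> s C = whiskering \<Delta> {1..s} C"
proof (intro set_eqI iffI)
  fix \<rho> assume "\<rho> \<in> partial_whiskering \<Delta> s C"
  then obtain \<sigma> T where \<rho>: "\<rho> = Inl ` \<sigma> \<union> Inr ` T"
    and *: "\<sigma> \<in> \<Delta>" "T \<subseteq> {1..s}" "\<forall>j\<in>T. \<sigma> \<inter> C j = {}"
    unfolding partial_whiskering_def mem_Collect_eq by (elim exE conjE)
  from \<rho> have "Inl -` \<rho> = \<sigma>" "Inr -` \<rho> = T"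
    by auto
  with * show "\<rho> \<in> whiskering \<Delta> {1..s} C"
    by (simp add: whiskering_def)
next
  fix \<rho> assume \<rho>: "\<rho> \<in> whiskering \<Delta> {1..s} C"
  show "\<rho> \<in> partial_whiskering \<Delta> s C"
    unfolding partial_whiskering_def mem_Collect_eq
  proof (intro exI conjI)
    show "\<rho> = Inl ` (Inl -` \<rho>) \<union> Inr ` (Inr -` \<rho>)"
      by (auto simp: image_iff) (metis sum.exhaust)
  qed (use \<rho> in \<open>simp_all add: whiskering_def\<close>)
qed

lemma simplicial_complex_mono:
  "simplicial_complex V \<Delta> \<Longrightarrow> \<sigma> \<in> \<Delta> \<Longrightarrow> \<tau> \<subseteq> \<sigma> \<Longrightarrow> \<tau> \<in> \<Delta>"
  unfolding simplicial_complex_def by blast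

lemma simplicial_complex_finite: "simplicial_complex V \<Delta> \<Longrightarrow> finite \<Delta>"
  by (rule finite_subset[of \<Delta> "Pow V"]) (auto simp: simplicial_complex_def)

lemma simplicial_complex_whiskering:
  assumes "simplicial_complex V \<Delta>" "finite T"
  shows "simplicial_complex (Inl ` V \<union> Inr ` T) (whiskering \<Delta> T C)"
  unfolding simplicial_complex_def
proof (intro conjI ballI allI impI)
  show "finite (Inl ` V \<union> Inr ` T)" "{} \<in> whiskering \<Delta> T C"
    using assms by (auto simp: simplicial_complex_def whiskering_def)
  show "whiskering \<Delta> T C \<subseteq> Pow (Inl ` V \<union> Inr ` T)"
  proof (intro subsetI PowI)
    fix \<rho> and z :: "'a + 'b" assume "\<rho> \<in> whiskering \<Delta> T C" "z \<in> \<rho>"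
    moreover from this have "Inl -` \<rho> \<subseteq> V" "Inr -` \<rho> \<subseteq> T"
      using assms(1) unfolding simplicial_complex_def whiskering_def by blast+
    ultimately show "z \<in> Inl ` V \<union> Inr ` T"
      by (cases z) auto
  qed
next
  fix \<rho> \<rho>' :: "('a + 'b) set" assume *: "\<rho> \<in> whiskering \<Delta> T C" "\<rho>' \<subseteq> \<rho>"
  then have "Inl -` \<rho>' \<in> \<Delta>"
    using simplicial_complex_mono[OF assms(1), of "Inl -` \<rho>" "Inl -` \<rho>'"]
    by (auto simp: whiskering_def)
  with * show "\<rho>' \<in> whiskering \<Delta> T C"
    unfolding whiskering_def by blast
qed

lemma is_simplex_Pow:
  assumes "finite F"
  shows "is_simplex (Pow F)"
proof -
  have "simplicial_complex F (Pow F)"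
    using assms by (auto simp: simplicial_complex_def)
  moreover have "facets (Pow F) = {F}"
    by (auto simp: facets_def)
  ultimately show ?thesis
    by (auto simp: is_simplex_def)
qed

lemma simplicial_complex_deletion:
  assumes "simplicial_complex V \<Delta>"
  shows "simplicial_complex (V - {w}) (deletion \<Delta> {w})"
  using assms simplicial_complex_mono[OF assms] by (auto simp: simplicial_complex_def deletion_def)

text \<open>The vertex set \<open>U\<close> is left open so that the induction can discard, besides
  \<open>w\<close>, all elements of \<open>V\<close> that share a colour with
  \<open>w\<close>.\<close>

lemma simplicial_complex_link:
  assumes \<Delta>: "simplicial_complex V \<Delta>" and "{w} \<in> \<Delta>"
    and U: "\<And>\<sigma>. \<sigma> \<in> link \<Delta> {w} \<Longrightarrow> \<sigma> \<subseteq> U" and "U \<subseteq> V"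
  shows "simplicial_complex U (link \<Delta> {w})"
proof -
  have "\<tau> \<in> link \<Delta> {w}" if "\<sigma> \<in> link \<Delta> {w}" "\<tau> \<subseteq> \<sigma>" for \<sigma> \<tau>
    using that simplicial_complex_mono[OF \<Delta>, of \<sigma> \<tau>]
      simplicial_complex_mono[OF \<Delta>, of "{w} \<union> \<sigma>" "{w} \<union> \<tau>"]
    by (auto simp: link_def)
  moreover have "finite U" "{} \<in> link \<Delta> {w}"
    using assms finite_subset by (auto simp: simplicial_complex_def link_def)
  ultimately show ?thesis
    using U by (auto simp: simplicial_complex_def)
qed

lemma deletion_whiskering:
  "deletion (whiskering \<Delta> T C) {Inl w} = whiskering (deletion \<Delta> {w}) T C"
  by (auto simp: deletion_def whiskering_def)

text \<open>A new vertex whose colour class contains \<open>w\<close> is never in a face with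
  \<open>w\<close>. For every other colour \<open>j\<close>, adding \<open>w\<close> to an old part
  does not change whether it meets \<open>C j\<close>.\<close>

lemma link_whiskering:
  "link (whiskering \<Delta> T C) {Inl w} = whiskering (link \<Delta> {w}) {j \<in> T. w \<notin> C j} C"
proof -
  have "Inl -` insert (Inl w) \<rho> = insert w (Inl -` \<rho>)" "Inr -` insert (Inl w) \<rho> = Inr -` \<rho>"
    for \<rho> :: "('a + 'b) set"
    by auto
  then show ?thesis
    by (intro set_eqI iffI)
      (simp_all add: link_def whiskering_def subset_iff Ball_def)
qed

text \<open>By \<open>ext\<close>, no face of the link is maximal in the deletion, so the two have
  no common facet. What remains to be shown about a shedding vertex is thus how to enlarge a face of
  its link while avoiding the vertex.\<close>

lemma vertex_decomposable_whiskering_shed: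
  assumes \<Delta>: "simplicial_complex V \<Delta>" and T: "finite T" and w: "{w} \<in> \<Delta>"
    and del: "vertex_decomposable (whiskering (deletion \<Delta> {w}) T C)"
    and lnk: "vertex_decomposable (whiskering (link \<Delta> {w}) {j \<in> T. w \<notin> C j} C)"
    and ext: "\<And>\<rho>. \<rho> \<in> whiskering (link \<Delta> {w}) {j \<in> T. w \<notin> C j} C \<Longrightarrow>
                \<exists>\<rho>'\<in>whiskering (deletion \<Delta> {w}) T C. \<rho> \<subset> \<rho>'"
  shows "vertex_decomposable (whiskering \<Delta> T C)"
proof (rule vertex_decomposable.shedding)
  show "simplicial_complex (Inl ` V \<union> Inr ` T) (whiskering \<Delta> T C)"
    by (rule simplicial_complex_whiskering[OF \<Delta> T])
  have "Inl -` {Inl w :: 'a + 'b} = {w}" "Inr -` {Inl w :: 'a + 'b} = {}"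
    by auto
  then show "{Inl w} \<in> whiskering \<Delta> T C"
    using w by (simp add: whiskering_def)
  show "facets (deletion (whiskering \<Delta> T C) {Inl w}) \<inter> facets (link (whiskering \<Delta> T C) {Inl w}) = {}"
    unfolding deletion_whiskering link_whiskering
  proof (rule equals0I)
    fix \<rho> assume "\<rho> \<in> facets (whiskering (deletion \<Delta> {w}) T C) \<inter>
      facets (whiskering (link \<Delta> {w}) {j \<in> T. w \<notin> C j} C)"
    then show False
      using ext[of \<rho>] by (auto simp: facets_def)
  qed
qed (use del lnk in \<open>simp_all add: deletion_whiskering link_whiskering\<close>)

text \<open>The colour condition is put on faces so that it passes to deletions and links, whose
  facets need not be facets of \<open>\<Delta>\<close>. The bound counts the elements of
  \<open>V\<close> without a colour in \<open>T\<close>, a number that both operations can be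
  arranged not to increase.\<close>

lemma vertex_decomposable_whiskering:
  fixes \<Delta> :: "'a set set" and C :: "'b \<Rightarrow> 'a set"
  assumes "simplicial_complex V \<Delta>" "finite T"
    and "\<And>\<sigma> j x y. \<lbrakk>\<sigma> \<in> \<Delta>; j \<in> T; x \<in> \<sigma> \<inter> C j; y \<in> \<sigma> \<inter> C j\<rbrakk> \<Longrightarrow> x = y"
    and "card (V - (\<Union>j\<in>T. C j)) \<le> 3"
  shows "vertex_decomposable (whiskering \<Delta> T C)"
  using assms
proof (induction "card V" arbitrary: V \<Delta> T rule: less_induct)
  case less
  note \<Delta> = less.prems(1) and T = less.prems(2) and col = less.prems(3) and le3 = less.prems(4)
  have finV: "finite V" and sub: "\<And>\<sigma>. \<sigma> \<in> \<Delta> \<Longrightarrow> \<sigma> \<subseteq> V" and empty: "{} \<in> \<Delta>"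
    using \<Delta> by (auto simp: simplicial_complex_def)
  note mono = simplicial_complex_mono[OF \<Delta>]
  have del: "vertex_decomposable (whiskering (deletion \<Delta> {w}) T C)" if w: "{w} \<in> \<Delta>" for w
  proof (rule less.hyps)
    show "card (V - {w}) < card V"
      using sub[OF w] finV by (intro psubset_card_mono) auto
    show "card (V - {w} - (\<Union>j\<in>T. C j)) \<le> 3"
      using finV by (intro order_trans[OF card_mono le3]) auto
  qed (use simplicial_complex_deletion[OF \<Delta>] T col in \<open>auto simp: deletion_def\<close>)
  have lnk: "vertex_decomposable (whiskering (link \<Delta> {w}) {j \<in> T. w \<notin> C j} C)"
    if w: "{w} \<in> \<Delta>" for w
  proof -
    \<comment> \<open>Dropping the colours of \<open>w\<close> would turn the other elements of
      those classes into uncoloured ones and could break the bound 3. None of them lies in a face of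
      the link, by \<open>col\<close>, so they can be removed from the vertex set.\<close>
    define U where "U = V - {w} - (\<Union>j\<in>{j \<in> T. w \<in> C j}. C j)"
    have "x \<in> U" if "\<sigma> \<in> link \<Delta> {w}" "x \<in> \<sigma>" for \<sigma> x
      using that sub col[of "{w} \<union> \<sigma>" _ x w] by (auto simp: link_def U_def)
    then have "simplicial_complex U (link \<Delta> {w})"
      by (intro simplicial_complex_link[OF \<Delta> w]) (auto simp: U_def)
    moreover have "card U < card V"
      using sub[OF w] finV by (intro psubset_card_mono) (auto simp: U_def)
    moreover have "card (U - (\<Union>j\<in>{j \<in> T. w \<notin> C j}. C j)) \<le> 3"
      using finV by (intro order_trans[OF card_mono le3]) (auto simp: U_def)
    ultimately show ?thesis
      using T col by (intro less.hyps[of U]) (auto simp: link_def)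
  qed
  note shed = vertex_decomposable_whiskering_shed[OF \<Delta> T _ del lnk]
  show ?case
  proof (cases "\<exists>j\<in>T. \<exists>w\<in>C j. {w} \<in> \<Delta>")
    case True
    then obtain j w where j: "j \<in> T" "w \<in> C j" and w: "{w} \<in> \<Delta>"
      by blast
    show ?thesis
    proof (rule shed[OF w w w])
      fix \<rho> assume \<rho>: "\<rho> \<in> whiskering (link \<Delta> {w}) {j \<in> T. w \<notin> C j} C"
      have eq: "Inl -` insert (Inr j) \<rho> = Inl -` \<rho>" "Inr -` insert (Inr j) \<rho> = insert j (Inr -` \<rho>)"
        by auto
      \<comment> \<open>Together with \<open>w\<close> the old part of \<open>\<rho>\<close> is a
        face, and \<open>w\<close> is its only vertex of colour \<open>j\<close>. Once
        \<open>w\<close> is left out, the new vertex \<open>Inr j\<close> may therefore be added. It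
        is not yet in \<open>\<rho>\<close>, as \<open>j\<close> was dropped in the link.\<close>
      have "Inl -` \<rho> \<inter> C j = {}"
        using \<rho> j col[of "{w} \<union> Inl -` \<rho>" j _ w] by (auto simp: whiskering_def link_def)
      then have "insert (Inr j) \<rho> \<in> whiskering (deletion \<Delta> {w}) T C"
        using \<rho> j by (auto simp: whiskering_def link_def deletion_def eq)
      moreover have "Inr j \<notin> \<rho>"
        using \<rho> j by (auto simp: whiskering_def)
      ultimately show "\<exists>\<rho>'\<in>whiskering (deletion \<Delta> {w}) T C. \<rho> \<subset> \<rho>'"
        by blast
    qed
  next
    case False
    \<comment> \<open>A coloured element of a face would itself be a vertex. \<open>V\<close> may
      still contain coloured elements, but none of them lies in a face.\<close>
    then have uncol: "\<sigma> \<inter> C j = {}" if "\<sigma> \<in> \<Delta>" "j \<in> T" for \<sigma> j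
      using that mono by blast
    have "Max (card ` \<Delta>) \<in> card ` \<Delta>"
      using simplicial_complex_finite[OF \<Delta>] empty by (intro Max_in) auto
    then obtain F where F: "F \<in> \<Delta>" "card F = Max (card ` \<Delta>)"
      by force
    then have max: "card G \<le> card F" if "G \<in> \<Delta>" for G
      using that simplicial_complex_finite[OF \<Delta>] by simp
    note F = F(1)
    have finF: "finite F"
      using sub[OF F] finV finite_subset by blast
    show ?thesis
    proof (cases "\<exists>v. {v} \<in> \<Delta> \<and> v \<notin> F")
      case False
      \<comment> \<open>All vertices lie in \<open>F\<close>, and the new vertices are subject to no
        restriction since no face meets a colour class. Hence the whiskering is the full simplex on
        \<open>F\<close> and \<open>T\<close>.\<close>
      then have "\<Delta> = Pow F"
        using mono F by blast
      moreover have "\<rho> \<subseteq> Inl ` F \<union> Inr ` T \<longleftrightarrow> Inl -` \<rho> \<subseteq> F \<and> Inr -` \<rho> \<subseteq> T" for \<rho>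
        by (auto 0 3 simp: subset_iff image_iff) (metis sum.exhaust)
      moreover have "\<rho> \<in> whiskering \<Delta> T C \<longleftrightarrow> Inl -` \<rho> \<in> \<Delta> \<and> Inr -` \<rho> \<subseteq> T" for \<rho>
        unfolding whiskering_def using uncol by blast
      ultimately have "whiskering \<Delta> T C = Pow (Inl ` F \<union> Inr ` T)"
        by (simp add: set_eq_iff)
      then show ?thesis
        using is_simplex_Pow[of "Inl ` F \<union> Inr ` T"] finF T
        by (simp add: vertex_decomposable.simplex)
    next
      case True
      then obtain v where v: "{v} \<in> \<Delta>" "v \<notin> F"
        by blast
      have strict: "\<sigma> \<subset> F" if \<sigma>: "\<sigma> \<in> link \<Delta> {v}" for \<sigma>
      proof -
        \<comment> \<open>This is where the bound 3 enters: \<open>v\<close> is uncoloured, so at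
          most two uncoloured elements remain beside it, and both \<open>F\<close> and
          \<open>\<sigma>\<close> lie among them.\<close>
        define X where "X = V - (\<Union>j\<in>T. C j) - {v}"
        have "finite X" "v \<in> V - (\<Union>j\<in>T. C j)"
          using finV sub[OF v(1)] uncol[OF v(1)] by (auto simp: X_def)
        then have X: "card X \<le> 2"
          using le3 by (simp add: X_def)
        have sX: "\<sigma> \<subseteq> X" and FX: "F \<subseteq> X"
          using \<sigma> F v sub uncol by (fastforce simp: X_def link_def)+
        have "insert v \<sigma> \<in> \<Delta>" "v \<notin> \<sigma>"
          using \<sigma> by (auto simp: link_def)
        \<comment> \<open>Adding \<open>v\<close> to \<open>\<sigma>\<close> gives a face, which is
          no larger than \<open>F\<close>.\<close>
        then have lt: "card \<sigma> < card F"
          using max[of "insert v \<sigma>"] finite_subset[OF sX \<open>finite X\<close>] by simp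
        show ?thesis
        \<comment> \<open>If \<open>F\<close> has two elements it fills \<open>X\<close> and hence
          contains \<open>\<sigma>\<close>. Otherwise \<open>\<sigma>\<close> is empty and
          \<open>F\<close> is not.\<close>
        proof (cases "card F \<ge> 2")
          case True
          then have "F = X"
            using card_subset_eq[OF \<open>finite X\<close> FX] card_mono[OF \<open>finite X\<close> FX] X by simp
          then show ?thesis
            using sX lt by auto
        next
          case False
          then have "card \<sigma> = 0"
            using lt by linarith
          then have "\<sigma> = {}"
            using finite_subset[OF sX \<open>finite X\<close>] by simp
          then show ?thesis
            using lt by auto
        qed
      qed
      show ?thesis
      proof (rule shed[OF v(1) v(1) v(1)])
        fix \<rho> assume \<rho>: "\<rho> \<in> whiskering (link \<Delta> {v}) {j \<in> T. v \<notin> C j} C"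
        then have lt: "Inl -` \<rho> \<subset> F" and "Inr -` \<rho> \<subseteq> T"
          using strict by (auto simp: whiskering_def)
        have eq: "Inl -` (\<rho> \<union> Inl ` F) = Inl -` \<rho> \<union> F" "Inr -` (\<rho> \<union> Inl ` F) = Inr -` \<rho>"
          by auto
        \<comment> \<open>The old part grows to exactly \<open>F\<close>, which avoids
          \<open>v\<close>. The new part stays admissible because \<open>F\<close> meets no colour
          class.\<close>
        have "\<rho> \<union> Inl ` F \<in> whiskering (deletion \<Delta> {v}) T C"
          unfolding whiskering_def mem_Collect_eq eq
          using lt \<open>Inr -` \<rho> \<subseteq> T\<close> F v(2) uncol[OF F]
          by (auto simp: deletion_def Un_absorb1)
        moreover have "\<rho> \<subset> \<rho> \<union> Inl ` F"
          using lt by auto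
        ultimately show "\<exists>\<rho>'\<in>whiskering (deletion \<Delta> {v}) T C. \<rho> \<subset> \<rho>'"
          by blast
      qed
    qed
  qed
qed

lemma simplicial_complex_restriction:
  "simplicial_complex V \<Delta> \<Longrightarrow> simplicial_complex V (restriction \<Delta> W)"
  unfolding simplicial_complex_def restriction_def by blast

text \<open>Finiteness provides a maximal face above \<open>\<sigma>\<close>. This carries the
  colouring condition from facets over to all faces.\<close>

lemma simplicial_complex_face_subset_facet:
  assumes "simplicial_complex V \<Delta>" "\<sigma> \<in> \<Delta>"
  obtains F where "F \<in> facets \<Delta>" "\<sigma> \<subseteq> F"
proof -
  obtain F where "F \<in> \<Delta>" "\<sigma> \<subseteq> F" "\<And>G. G \<in> \<Delta> \<Longrightarrow> F \<subseteq> G \<Longrightarrow> F = G"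
    using finite_has_maximal2[OF simplicial_complex_finite[OF assms(1)] assms(2)] by metis
  then show thesis
    by (intro that[of F]) (auto simp: facets_def)
qed

theorem corollary3p7:
  fixes V W :: "'a set" and \<Delta> :: "'a set set" and s :: nat and C :: "nat \<Rightarrow> 'a set"
  assumes "simplicial_complex V \<Delta>"
    and "W \<subseteq> V"
    and "coloring W (restriction \<Delta> W) s C"
    and "card (V - W) \<le> 3"
  shows "vertex_decomposable (partial_whiskering \<Delta> s C)"
proof -
  have W: "W = (\<Union>j\<in>{1..s}. C j)"
    and card_le: "\<And>F j. F \<in> facets (restriction \<Delta> W) \<Longrightarrow> j \<in> {1..s} \<Longrightarrow> card (F \<inter> C j) \<le> 1"
    using assms(3) by (auto simp: coloring_def)
  note res = simplicial_complex_restriction[OF assms(1), of W]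
  have "x = y" if \<sigma>: "\<sigma> \<in> \<Delta>" "j \<in> {1..s}" "x \<in> \<sigma> \<inter> C j" "y \<in> \<sigma> \<inter> C j" for \<sigma> j x y
  proof -
    \<comment> \<open>Both \<open>x\<close> and \<open>y\<close> lie in \<open>W\<close>, so they
      survive in the trace of \<open>\<sigma>\<close> on \<open>W\<close> and in a facet of the
      restriction above it, where the colouring bound applies.\<close>
    have "\<sigma> \<inter> W \<in> restriction \<Delta> W"
      using simplicial_complex_mono[OF assms(1) \<sigma>(1)] by (auto simp: restriction_def)
    then obtain F where F: "F \<in> facets (restriction \<Delta> W)" "\<sigma> \<inter> W \<subseteq> F"
      using simplicial_complex_face_subset_facet[OF res] by blast
    \<comment> \<open>As \<open>card\<close> is 0 on infinite sets, the bound
      \<open>card (F \<inter> C j) \<le> 1\<close> identifies \<open>x\<close> and \<open>y\<close>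
      only once \<open>F\<close> is known to be finite.\<close>
    have "finite F"
    proof (rule finite_subset)
      show "F \<subseteq> V" "finite V"
        using F(1) res by (auto simp: facets_def simplicial_complex_def)
    qed
    moreover have "x \<in> F \<inter> C j" "y \<in> F \<inter> C j"
      using \<sigma> F(2) W by blast+
    ultimately show "x = y"
      using card_le[OF F(1) \<sigma>(2)] by (simp add: card_le_Suc0_iff_eq)
  qed
  then show ?thesis
    unfolding partial_whiskering_eq_whiskering
    using assms(4) W by (intro vertex_decomposable_whiskering[OF assms(1)]) simp_all
qed

end
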